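(* Let $\widetilde f\colon\mathbb R^{\widetilde N}\to(-\infty,+\infty]$ be convex and $\widetilde\beta$-Lipschitz differentiable with $\widetilde\beta>0$, let $\widetilde g\colon\mathbb R^{\widetilde N}\to(-\infty,+\infty]$ be convex, proper and lower semi-continuous, and let $\lambda,\mu>0$. For $L\in\mathbb N\setminus\{0\}$, let $\widetilde G_{L,\lambda\mu^{-1}}\colon\mathbb R^{\widetilde N}\times\mathbb R^{\widetilde N}\to\mathbb R^{\widetilde N}$ be an operator, let $\tau>0$, $x_0,u_0\in\mathbb R^{\widetilde N}$, and let $(x_k)_{k\in\mathbb N}$ and $(u_k)_{k\in\mathbb N}$ be generated by: for $k=0,1,\ldots$ $$ \begin{aligned} x_{k+1}&=x_k-\tau\nabla_xF(x_k,u_k),\\ u_{k+1}&=\widetilde G_{L,\lambda\mu^{-1}}(x_{k+1},u_k), \end{aligned} $$ where $F(x,u)=\widetilde f(x)+\widetilde g_\lambda(u)+\frac\mu2\|x-u\|^2$ and $\nabla_xF(x,u)=\nabla\widetilde f(x)+\mu(x-u)$. For $x\in\mathbb R^{\widetilde N}$ write $u^\ddagger_x=\operatorname{prox}_{\widetilde g_{\lambda/\mu}}(x)$. Assume that: (i) there exists $\alpha_L\in\,]0,1/\sqrt2[$ such that, for every $k\in\mathbb N$, $$\|\widetilde G_{L,\lambda\mu^{-1}}(x_{k+1},u_k)-u^\ddagger_{x_{k+1}}\|\le\alpha_L\|u_k-u^\ddagger_{x_{k+1}}\|;$$ (ii) the step-size satisfies $0<\tau<\dfrac{2\phi^\ddagger(1-2\alpha_L^2)}{\mu^2}$,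 where $\phi^\ddagger>0$ is the positive root of the polynomial $$p(\phi)=8\alpha_L^2(1-2\alpha_L^2)\phi^2+2(\widetilde\beta+\mu)(1-2\alpha_L^2)\phi-\mu^2.$$ Then $(x_k)_{k\in\mathbb N}$ converges to a solution to the bi-level problem: find $$x^\ddagger=\operatorname*{argmin}_{x\in\mathbb R^{\widetilde N}}F(x,u^\ddagger_x)\quad\text{such that}\quad u^\ddagger_x=\operatorname{prox}_{\widetilde g_{\lambda/\mu}}(x).$$
   Context: For $c>0$, $\widetilde g_c:=c\,\widetilde g$. $\|\cdot\|$ is the Euclidean norm. $\widetilde\beta$-Lipschitz differentiable means differentiable with $\widetilde\beta$-Lipschitz gradient. For a proper lower semi-continuous convex function $h$, $\operatorname{prox}_h(v)=\operatorname{argmin}_x h(x)+\frac12\|x-v\|^2$. By convention $\operatorname{argmin}$ denotes the unique minimizer; the bi-level problem, posed as "find $x^\ddagger=\operatorname{argmin}$", is accordingly understood to have a unique minimizer $x^\ddagger$. It is equivalent to minimizing $\widetilde f(x)+{}^\mu\widetilde g_\lambda(x)$, where ${}^\mu\widetilde g_\lambda(x)=\min_{u\in\mathbb R^{\widetilde N}}\widetilde g_\lambda(u)+\frac\mu2\|x-u\|^2$ is the Moreau–Yosida envelope. The operator $\widetilde G_{L,\lambda\mu^{-1}}$ represents $L$ sub-iterations of some iterative algorithm aiming to approximate $\operatorname{prox}_{\widetilde g_{\lambda/\mu}}$ at its first argument, initialized at its second argument; only assumption (i) is imposed on it. *)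

theory Defs
  imports "HOL-Analysis.Analysis"
begin

definition argmin :: "('a \<Rightarrow> ereal) \<Rightarrow> 'a" where
  "argmin h = (THE x. is_arg_min h (\<lambda>_. True) x)"

(* Functions into (-oo,+oo] are modelled as ereal-valued functions avoiding -oo. *)

definition no_minus_infty :: "('a \<Rightarrow> ereal) \<Rightarrow> bool" where
  "no_minus_infty h \<longleftrightarrow> (\<forall>x. h x \<noteq> -\<infinity>)"

definition proper_fun :: "('a \<Rightarrow> ereal) \<Rightarrow> bool" where
  "proper_fun h \<longleftrightarrow> no_minus_infty h \<and> (\<exists>x. h x \<noteq> \<infinity>)"

(* The library's convex_on only covers real-valued functions.  The weight t is strictly
   between 0 and 1, so no product 0 * oo occurs. *)
definition convex_fun :: "('a::real_vector \<Rightarrow> ereal) \<Rightarrow> bool" where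
  "convex_fun h \<longleftrightarrow>
     (\<forall>x y. \<forall>t\<in>{0<..<1}. h ((1 - t) *\<^sub>R x + t *\<^sub>R y) \<le> ereal (1 - t) * h x + ereal t * h y)"

definition lsc_fun :: "('a::topological_space \<Rightarrow> ereal) \<Rightarrow> bool" where
  "lsc_fun h \<longleftrightarrow> (\<forall>x. h x \<le> Liminf (at x) h)"

definition scale_fun :: "real \<Rightarrow> ('a \<Rightarrow> ereal) \<Rightarrow> 'a \<Rightarrow> ereal" where
  "scale_fun c h = (\<lambda>x. ereal c * h x)"

definition prox :: "('a::real_normed_vector \<Rightarrow> ereal) \<Rightarrow> 'a \<Rightarrow> 'a" where
  "prox h v = argmin (\<lambda>x. h x + ereal ((norm (x - v))\<^sup>2 / 2))"

definition grad :: "('a::real_inner \<Rightarrow> ereal) \<Rightarrow> 'a \<Rightarrow> 'a" where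
  "grad h x = (THE D. GDERIV (\<lambda>y. real_of_ereal (h y)) x :> D)"

(* Differentiability on the whole space includes finiteness everywhere; this must be required
   separately because real_of_ereal maps infinite values to 0. *)
definition lipschitz_differentiable :: "real \<Rightarrow> ('a::real_inner \<Rightarrow> ereal) \<Rightarrow> bool" where
  "lipschitz_differentiable b h \<longleftrightarrow>
     (\<forall>x. \<bar>h x\<bar> \<noteq> \<infinity>) \<and>
     (\<forall>x. (\<lambda>y. real_of_ereal (h y)) differentiable (at x)) \<and>
     b-lipschitz_on UNIV (grad h)"

definition F_obj ::
  "('a::real_normed_vector \<Rightarrow> ereal) \<Rightarrow> ('a \<Rightarrow> ereal) \<Rightarrow> real \<Rightarrow> real \<Rightarrow> 'a \<Rightarrow> 'a \<Rightarrow> ereal" where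
  "F_obj f g lam mu x u = f x + scale_fun lam g u + ereal (mu / 2 * (norm (x - u))\<^sup>2)"

definition grad_x_F :: "('a::real_inner \<Rightarrow> ereal) \<Rightarrow> real \<Rightarrow> 'a \<Rightarrow> 'a \<Rightarrow> 'a" where
  "grad_x_F f mu x u = grad f x + mu *\<^sub>R (x - u)"

definition lower_sol :: "('a::real_normed_vector \<Rightarrow> ereal) \<Rightarrow> real \<Rightarrow> real \<Rightarrow> 'a \<Rightarrow> 'a" where
  "lower_sol g lam mu x = prox (scale_fun (lam / mu) g) x"

definition bilevel_obj ::
  "('a::real_normed_vector \<Rightarrow> ereal) \<Rightarrow> ('a \<Rightarrow> ereal) \<Rightarrow> real \<Rightarrow> real \<Rightarrow> 'a \<Rightarrow> ereal" where
  "bilevel_obj f g lam mu x = F_obj f g lam mu x (lower_sol g lam mu x)"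

end

theory Submission
  imports Defs
begin

text \<open>Write \<open>h\<close> for \<open>(lam / \<mu>) g\<close>.  The reduced objective is \<open>f\<close> plus \<open>\<mu>\<close> times the Moreau envelope of
  \<open>h\<close>; it is convex with a \<open>(\<beta> + \<mu>)\<close>-Lipschitz gradient, and the scheme is gradient descent on it
  with the error \<open>u k - prox h (x k)\<close>.  Since the proximity operator is nonexpansive, the squared error
  after one step is at most \<open>2\<alpha>\<^sup>2\<close> times the sum of the squared error and the squared step length.
  Hence the objective plus \<open>\<phi>\<close> times the squared error is a Lyapunov function, so steps, errors and
  gradients tend to 0.  Away from its unique minimizer a convex function grows at least linearly, so
  vanishing gradients force convergence to the minimizer.\<close>

subsection \<open>Lower semicontinuous functions\<close>

lemma is_arg_min_UNIV_iff:
  fixes h :: "'a \<Rightarrow> 'b::linorder"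
  shows "is_arg_min h (\<lambda>_. True) p \<longleftrightarrow> (\<forall>y. h p \<le> h y)"
  by (auto simp: is_arg_min_def not_less)

lemma argmin_eqI:
  assumes "\<And>y. h p \<le> h y" "\<And>q. (\<And>y. h q \<le> h y) \<Longrightarrow> q = p"
  shows "argmin h = p"
  unfolding argmin_def is_arg_min_UNIV_iff using assms by (intro the_equality) auto

lemma lsc_fun_iff_eventually:
  "lsc_fun h \<longleftrightarrow> (\<forall>x. \<forall>c<h x. eventually (\<lambda>y. c < h y) (at x))"
  unfolding lsc_fun_def le_Liminf_iff ..

lemma lsc_fun_closed_level:
  assumes "lsc_fun h"
  shows "closed {y. h y \<le> c}"
proof -
  have "open {y. c < h y}"
  proof (subst open_subopen, rule ballI)
    fix x assume "x \<in> {y. c < h y}"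
    then have "c < h x" by simp
    then have "eventually (\<lambda>y. c < h y) (nhds x)"
      using assms unfolding lsc_fun_iff_eventually eventually_nhds_conv_at by auto
    then show "\<exists>T. open T \<and> x \<in> T \<and> T \<subseteq> {y. c < h y}"
      unfolding eventually_nhds by auto
  qed
  moreover have "{y. h y \<le> c} = - {y. c < h y}" by auto
  ultimately show ?thesis by (simp add: closed_def)
qed

text \<open>The closed sets \<open>{y. h y \<le> c}\<close>, with \<open>c\<close> ranging over the
  values of \<open>h\<close> on \<open>K\<close>, have the finite intersection property on
  \<open>K\<close>: a point realizing the least of finitely many values lies in all of them. A
  common point of the whole family is a minimizer.\<close>

lemma lsc_fun_attains_inf:
  assumes "lsc_fun h" "compact K" "K \<noteq> {}"
  shows "\<exists>p\<in>K. \<forall>y\<in>K. h p \<le> h y"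
proof -
  have "K \<inter> (\<Inter>c\<in>h ` K. {y. h y \<le> c}) \<noteq> {}"
  proof (rule compact_imp_fip_image[OF assms(2)])
    fix I assume I: "finite I" "I \<subseteq> h ` K"
    show "K \<inter> (\<Inter>c\<in>I. {y. h y \<le> c}) \<noteq> {}"
    proof (cases "I = {}")
      case True
      then show ?thesis using assms(3) by auto
    next
      case False
      then have "Min I \<in> h ` K" using I Min_in by blast
      then obtain y where "y \<in> K" "h y = Min I" by auto
      then show ?thesis using I by auto
    qed
  qed (rule lsc_fun_closed_level[OF assms(1)])
  then show ?thesis by auto
qed

lemma lsc_fun_add_continuous:
  fixes q :: "'a::topological_space \<Rightarrow> real"
  assumes "lsc_fun h" "continuous_on UNIV q"
  shows "lsc_fun (\<lambda>y. h y + ereal (q y))"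
  unfolding lsc_fun_iff_eventually
proof (intro allI impI)
  fix x c assume c: "c < h x + ereal (q x)"
  then have "c - ereal (q x) < h x"
    by (cases c; cases "h x") auto
  \<comment> \<open>The real threshold \<open>r\<close> decouples the summands: near
    \<open>x\<close>, \<open>h\<close> stays above \<open>r\<close> by semicontinuity, and
    \<open>r + q\<close> stays above \<open>c\<close> by continuity.\<close>
  then obtain r where r: "c - ereal (q x) < ereal r" "ereal r < h x"
    using ereal_dense2 by blast
  have "eventually (\<lambda>y. ereal r < h y) (at x)"
    using assms(1) r(2) unfolding lsc_fun_iff_eventually by blast
  moreover have "eventually (\<lambda>y. c < ereal r + ereal (q y)) (at x)"
  proof (cases c)
    case (real c')
    have "(q \<longlongrightarrow> q x) (at x)"
      using assms(2) by (simp add: continuous_on_def)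
    moreover have "c' - r < q x" using r(1) real by simp
    ultimately have "eventually (\<lambda>y. c' - r < q y) (at x)" by (rule order_tendstoD)
    then show ?thesis by eventually_elim (simp add: real)
  qed (use c in auto)
  ultimately show "eventually (\<lambda>y. c < h y + ereal (q y)) (at x)"
  proof eventually_elim
    case (elim y)
    have "ereal r + ereal (q y) \<le> h y + ereal (q y)"
      using elim(1) by (intro add_right_mono) simp
    then show ?case using elim(2) by (rule less_le_trans[rotated])
  qed
qed

lemma proper_fun_scale: "proper_fun h \<Longrightarrow> c > 0 \<Longrightarrow> proper_fun (scale_fun c h)"
  by (auto simp: proper_fun_def no_minus_infty_def scale_fun_def)

lemma lsc_fun_scale:
  assumes "lsc_fun h" "c > 0"
  shows "lsc_fun (scale_fun c h)"
  unfolding lsc_fun_iff_eventually scale_fun_def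
proof (intro allI impI)
  fix x b assume b: "b < ereal c * h x"
  have *: "b < ereal c * y \<longleftrightarrow> b / ereal c < y" for y
    using assms(2) by (simp add: ereal_divide_less_iff mult.commute)
  from b have "eventually (\<lambda>y. b / ereal c < h y) (at x)"
    using assms(1) unfolding lsc_fun_iff_eventually * by blast
  then show "eventually (\<lambda>y. b < ereal c * h y) (at x)" unfolding * .
qed

lemma convex_fun_scale:
  assumes "convex_fun h" "c > 0"
  shows "convex_fun (scale_fun c h)"
  unfolding convex_fun_def scale_fun_def
proof (intro allI ballI)
  fix x y and t :: real assume t: "t \<in> {0<..<1}"
  have "ereal c * h ((1 - t) *\<^sub>R x + t *\<^sub>R y) \<le> ereal c * (ereal (1 - t) * h x + ereal t * h y)"
    using assms t by (intro ereal_mult_left_mono) (auto simp: convex_fun_def)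
  also have "\<dots> = ereal (1 - t) * (ereal c * h x) + ereal t * (ereal c * h y)"
    using assms(2) t by (cases "h x"; cases "h y") (auto simp: algebra_simps)
  finally show "ereal c * h ((1 - t) *\<^sub>R x + t *\<^sub>R y) \<le> ereal (1 - t) * (ereal c * h x) + ereal t * (ereal c * h y)" .
qed

subsection \<open>The proximity operator\<close>

text \<open>A substitute for an affine minorant. The minimum over the unit ball around
  \<open>z0\<close> settles nearby points; farther out, a faster than linear decrease would, by
  convexity on the segment from \<open>z0\<close> to \<open>z\<close>, push \<open>h\<close> below
  that minimum on the unit sphere.\<close>

lemma proper_convex_lsc_lower_bound:
  fixes h :: "'a::euclidean_space \<Rightarrow> ereal"
  assumes "proper_fun h" "convex_fun h" "lsc_fun h" "h z0 \<noteq> \<infinity>"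
  shows "\<exists>A\<ge>0. \<forall>z. ereal (- (A * (1 + norm (z - z0)))) \<le> h z"
proof -
  obtain p where p: "p \<in> cball z0 1" "\<And>y. y \<in> cball z0 1 \<Longrightarrow> h p \<le> h y"
    using lsc_fun_attains_inf[OF assms(3) compact_cball[of z0 1]] by auto
  have nm: "h y \<noteq> -\<infinity>" for y
    using assms(1) by (auto simp: proper_fun_def no_minus_infty_def)
  obtain g0 where g0: "h z0 = ereal g0" using nm[of z0] assms(4) by (cases "h z0") auto
  obtain m where m: "h p = ereal m" using nm[of p] p(2)[of z0] g0 by (cases "h p") auto
  \<comment> \<open>\<open>\<bar>m\<bar>\<close> accounts for the minimum on the ball,
    \<open>\<bar>g0\<bar>\<close> for the term with \<open>h z0\<close> in the convexity
    inequality.\<close>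
  define A where "A = \<bar>m\<bar> + \<bar>g0\<bar>"
  have "ereal (- (A * (1 + norm (z - z0)))) \<le> h z" for z
  proof (cases "norm (z - z0) \<le> 1")
    case True
    then have "ereal m \<le> h z" using p(2)[of z] m by (simp add: dist_norm norm_minus_commute)
    moreover have "- (A * (1 + norm (z - z0))) \<le> m"
    proof -
      have "A * 1 \<le> A * (1 + norm (z - z0))"
        unfolding A_def by (intro mult_left_mono) auto
      moreover have "- A \<le> m" unfolding A_def by arith
      ultimately show ?thesis by simp
    qed
    ultimately show ?thesis using order_trans ereal_less_eq(3) by blast
  next
    case False
    define r where "r = norm (z - z0)"
    have r: "r > 1" using False r_def by simp
    \<comment> \<open>The point where the segment from \<open>z0\<close> to \<open>z\<close> crosses
      the unit sphere, so that \<open>m\<close> bounds \<open>h w\<close> from below.\<close>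
    define w where "w = (1 - 1/r) *\<^sub>R z0 + (1/r) *\<^sub>R z"
    have "w - z0 = (1/r) *\<^sub>R (z - z0)" by (simp add: w_def algebra_simps)
    then have "norm (w - z0) = norm (z - z0) / r" using r by simp
    then have "norm (w - z0) = 1" using r by (simp flip: r_def)
    then have "ereal m \<le> h w" using p(2)[of w] m by (simp add: dist_norm norm_minus_commute)
    also have "\<dots> \<le> ereal (1 - 1/r) * h z0 + ereal (1/r) * h z"
      unfolding w_def using assms(2) r by (auto simp: convex_fun_def)
    finally have *: "ereal m \<le> ereal (1 - 1/r) * h z0 + ereal (1/r) * h z" .
    show ?thesis
    proof (cases "h z")
      case (real s)
      have "m \<le> (1 - 1/r) * g0 + s / r" using * real g0 by simp
      then have "r * m \<le> (r - 1) * g0 + s" using r by (simp add: field_simps)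
      moreover have "- (r * \<bar>m\<bar>) \<le> r * m" using r by (simp add: abs_if)
      moreover have "(r - 1) * g0 \<le> r * \<bar>g0\<bar>"
        using r mult_left_mono[of g0 "\<bar>g0\<bar>" "r - 1"] mult_right_mono[of "r - 1" r "\<bar>g0\<bar>"] by linarith
      moreover have "A * (1 + r) = \<bar>m\<bar> + \<bar>g0\<bar> + r * \<bar>m\<bar> + r * \<bar>g0\<bar>"
        by (simp add: A_def algebra_simps)
      ultimately have "- (A * (1 + r)) \<le> s" by linarith
      then show ?thesis using real r_def by simp
    qed (use nm[of z] in auto)
  qed
  moreover have "A \<ge> 0" by (simp add: A_def)
  ultimately show ?thesis by blast
qed

text \<open>The quadratic term outgrows the linear lower bound on \<open>h\<close>, so far points
  have values above the one at \<open>z0\<close>, and a minimizer over a large ball is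
  global.\<close>

lemma prox_exists:
  fixes h :: "'a::euclidean_space \<Rightarrow> ereal"
  assumes h: "proper_fun h" "convex_fun h" "lsc_fun h"
  shows "\<exists>p. \<forall>y. h p + ereal ((norm (p - v))\<^sup>2 / 2) \<le> h y + ereal ((norm (y - v))\<^sup>2 / 2)"
proof -
  define H where "H = (\<lambda>y. h y + ereal ((norm (y - v))\<^sup>2 / 2))"
  obtain z0 where z0: "h z0 \<noteq> \<infinity>" using h(1) by (auto simp: proper_fun_def)
  then obtain g0 where g0: "h z0 = ereal g0"
    using h(1) by (cases "h z0") (auto simp: proper_fun_def no_minus_infty_def)
  obtain A where A: "A \<ge> 0" "\<And>z. ereal (- (A * (1 + norm (z - z0)))) \<le> h z"
    using proper_convex_lsc_lower_bound[OF h z0] by blast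
  define B where "B = g0 + (norm (z0 - v))\<^sup>2 / 2"
  define d where "d = norm (z0 - v)"
  \<comment> \<open>Chosen so that \<open>r > R\<close> gives
    \<open>r / 2 - (d + A) \<ge> A + \<bar>B\<bar> + 1\<close>; multiplied by
    \<open>r \<ge> 1\<close>, this lifts the objective above its value \<open>B\<close> at
    \<open>z0\<close>.\<close>
  define R where "R = 2 * (d + A) + 2 * (A + \<bar>B\<bar>) + 2"
  have d: "d \<ge> 0" by (simp add: d_def)
  have R: "R \<ge> 1" using A(1) d abs_ge_zero[of B] unfolding R_def by argo
  have HB: "H z0 = ereal B" by (simp add: H_def g0 B_def)
  have "lsc_fun H" unfolding H_def
    by (intro lsc_fun_add_continuous h continuous_intros) auto
  then obtain p where p: "\<And>y. y \<in> cball z0 R \<Longrightarrow> H p \<le> H y"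
    using lsc_fun_attains_inf[OF _ compact_cball[of z0 R]] R by fastforce
  have "H p \<le> H y" for y
  proof (cases "y \<in> cball z0 R")
    case False
    define r where "r = norm (y - z0)"
    have r: "r > R" using False by (simp add: r_def dist_norm norm_minus_commute)
    have "r \<le> norm (y - v) + d"
      unfolding r_def d_def by norm
    then have "(r - d)\<^sup>2 \<le> (norm (y - v))\<^sup>2"
      using r d A(1) by (intro power_mono) (auto simp: R_def)
    then have 1: "(norm (y - v))\<^sup>2 / 2 \<ge> r * (r / 2) - r * d"
      by (simp add: power2_diff power2_eq_square algebra_simps) (use zero_le_square[of d] in linarith)
    have "1 * (A + \<bar>B\<bar> + 1) \<le> r * (r / 2 - (d + A))"
      using r R A(1) by (intro mult_mono) (auto simp: R_def)
    then have "B \<le> - (A * (1 + r)) + (norm (y - v))\<^sup>2 / 2"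
      using 1 by (simp add: algebra_simps)
    then have "ereal B \<le> ereal (- (A * (1 + r))) + ereal ((norm (y - v))\<^sup>2 / 2)" by simp
    also have "\<dots> \<le> H y"
      unfolding H_def r_def by (intro add_right_mono A(2))
    finally show ?thesis using p[of z0] R HB by simp
  qed (rule p)
  then show ?thesis unfolding H_def by blast
qed

text \<open>The optimality condition $v - p \in \partial h(p)$, from comparing $p$ with
  $(1-t)p + ty$ as $t \to 0$.\<close>

lemma prox_minimizer_subgradient:
  fixes h :: "'a::real_inner \<Rightarrow> ereal"
  assumes h: "proper_fun h" "convex_fun h"
    and min: "\<And>y. h p + ereal ((norm (p - v))\<^sup>2 / 2) \<le> h y + ereal ((norm (y - v))\<^sup>2 / 2)"
  shows "\<bar>h p\<bar> \<noteq> \<infinity>" "h p + ereal (inner (v - p) (y - p)) \<le> h y"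
proof -
  have nm: "h y \<noteq> -\<infinity>" for y
    using h(1) by (auto simp: proper_fun_def no_minus_infty_def)
  obtain z0 where "h z0 \<noteq> \<infinity>" using h(1) by (auto simp: proper_fun_def)
  with min[of z0] have "h p \<noteq> \<infinity>" by (cases "h z0") auto
  then obtain a where a: "h p = ereal a" using nm[of p] by (cases "h p") auto
  then show "\<bar>h p\<bar> \<noteq> \<infinity>" by simp
  show "h p + ereal (inner (v - p) (y - p)) \<le> h y"
  proof (cases "h y")
    case (real b)
    have t: "a + inner (v - p) (y - p) \<le> b + t * ((norm (y - p))\<^sup>2 / 2)" if "0 < t" "t < 1" for t
    proof -
      define w where "w = (1 - t) *\<^sub>R p + t *\<^sub>R y"
      have "h w \<le> ereal (1 - t) * h p + ereal t * h y"
        unfolding w_def using h(2) that by (auto simp: convex_fun_def)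
      then have "h w \<le> ereal ((1 - t) * a + t * b)" using a real by simp
      have "ereal (a + (norm (p - v))\<^sup>2 / 2) \<le> h w + ereal ((norm (w - v))\<^sup>2 / 2)"
        using min[of w] a by simp
      also have "\<dots> \<le> ereal ((1 - t) * a + t * b) + ereal ((norm (w - v))\<^sup>2 / 2)"
        by (rule add_right_mono) fact
      finally have 1: "a + (norm (p - v))\<^sup>2 / 2 \<le> (1 - t) * a + t * b + (norm (w - v))\<^sup>2 / 2"
        by simp
      have "w - v = (p - v) + t *\<^sub>R (y - p)" by (simp add: w_def algebra_simps)
      have "(norm (w - v))\<^sup>2 = (norm (p - v))\<^sup>2 + 2 * t * inner (p - v) (y - p) + t\<^sup>2 * (norm (y - p))\<^sup>2"
        unfolding \<open>w - v = _\<close> power2_norm_eq_inner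
        by (simp add: inner_simps algebra_simps power2_eq_square inner_commute)
      with 1 have "t * (a + inner (v - p) (y - p)) \<le> t * (b + t * ((norm (y - p))\<^sup>2 / 2))"
        by (simp add: algebra_simps power2_eq_square inner_simps)
      then show ?thesis using that by simp
    qed
    have "((\<lambda>t. b + t * ((norm (y - p))\<^sup>2 / 2)) \<longlongrightarrow> b + 0 * ((norm (y - p))\<^sup>2 / 2)) (at_right 0)"
      by (intro tendsto_intros)
    then have "a + inner (v - p) (y - p) \<le> b + 0 * ((norm (y - p))\<^sup>2 / 2)"
      by (rule tendsto_lowerbound)
        (use t in \<open>auto simp: eventually_at_right_field intro!: exI[of _ 1]\<close>)
    then show ?thesis using a real by simp
  qed (use nm[of y] in auto)
qed

text \<open>Gives \<open>prox\<close>, a definite description, its meaning. Uniqueness comes from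
  monotonicity: adding the optimality conditions of two minimizers \<open>p\<close> and
  \<open>q\<close>, each tested at the other, leaves
  \<open>inner (q - p) (q - p) \<le> 0\<close>.\<close>

lemma prox_subgradient:
  fixes h :: "'a::euclidean_space \<Rightarrow> ereal"
  assumes h: "proper_fun h" "convex_fun h" "lsc_fun h"
  shows "\<bar>h (prox h v)\<bar> \<noteq> \<infinity>"
    "h (prox h v) + ereal (inner (v - prox h v) (y - prox h v)) \<le> h y"
proof -
  let ?H = "\<lambda>y. h y + ereal ((norm (y - v))\<^sup>2 / 2)"
  obtain p where p: "\<And>y. ?H p \<le> ?H y"
    using prox_exists[OF h] by blast
  note P = prox_minimizer_subgradient[OF h(1,2) p]
  have "prox h v = p" unfolding prox_def
  proof (rule argmin_eqI)
    show "?H p \<le> ?H y" for y by (rule p)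
    fix q assume "\<And>y. ?H q \<le> ?H y"
    note Q = prox_minimizer_subgradient[OF h(1,2) this]
    have "inner (v - p) (q - p) + inner (v - q) (p - q) \<le> 0"
      using P(1) Q(1) P(2)[of q] Q(2)[of p] by (cases "h p"; cases "h q") auto
    moreover have "inner (v - p) (q - p) + inner (v - q) (p - q) = inner (q - p) (q - p)"
      by (simp add: inner_simps inner_commute)
    ultimately show "q = p" by (smt (verit) inner_gt_zero_iff right_minus_eq)
  qed
  then show "\<bar>h (prox h v)\<bar> \<noteq> \<infinity>"
    "h (prox h v) + ereal (inner (v - prox h v) (y - prox h v)) \<le> h y"
    using P by auto
qed

text \<open>Testing each subgradient inequality at the other proximal point and adding gives firm
  nonexpansiveness; Cauchy-Schwarz does the rest.\<close>

lemma prox_nonexpansive: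
  fixes h :: "'a::euclidean_space \<Rightarrow> ereal"
  assumes h: "proper_fun h" "convex_fun h" "lsc_fun h"
  shows "norm (prox h v - prox h w) \<le> norm (v - w)"
proof -
  let ?p = "prox h v" and ?q = "prox h w"
  have "inner (v - ?p) (?q - ?p) + inner (w - ?q) (?p - ?q) \<le> 0"
    using prox_subgradient(1)[OF h, of v] prox_subgradient(1)[OF h, of w]
      prox_subgradient(2)[OF h, of v ?q] prox_subgradient(2)[OF h, of w ?p]
    by (cases "h ?p"; cases "h ?q") auto
  then have "(norm (?p - ?q))\<^sup>2 \<le> inner (v - w) (?p - ?q)"
    by (simp add: power2_norm_eq_inner inner_simps inner_commute)
  also have "\<dots> \<le> norm (v - w) * norm (?p - ?q)" by (rule norm_cauchy_schwarz)
  finally have "norm (?p - ?q) * norm (?p - ?q) \<le> norm (v - w) * norm (?p - ?q)"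
    by (simp add: power2_eq_square)
  then show ?thesis by (cases "?p = ?q") auto
qed

text \<open>By \<open>prox_subgradient\<close> the value of \<open>h\<close> at the proximal point
  is finite, so \<open>real_of_ereal\<close> loses nothing.\<close>

definition moreau :: "('a::real_normed_vector \<Rightarrow> ereal) \<Rightarrow> 'a \<Rightarrow> real" where
  "moreau h v = real_of_ereal (h (prox h v)) + (norm (v - prox h v))\<^sup>2 / 2"

text \<open>Together the bounds say that the envelope is convex and 1-smooth with gradient
  \<open>v - prox h v\<close>; they serve below in place of a derivative. The lower one uses the
  subgradient at \<open>prox h v\<close>, the upper one that at \<open>prox h w\<close>.\<close>

lemma
  fixes h :: "'a::euclidean_space \<Rightarrow> ereal"
  assumes h: "proper_fun h" "convex_fun h" "lsc_fun h"
  shows moreau_lower: "moreau h v + inner (v - prox h v) (w - v) \<le> moreau h w"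
    and moreau_upper: "moreau h w \<le> moreau h v + inner (v - prox h v) (w - v) + (norm (w - v))\<^sup>2 / 2"
proof -
  let ?p = "prox h v" and ?q = "prox h w"
  obtain a b where ab: "h ?p = ereal a" "h ?q = ereal b"
    using prox_subgradient(1)[OF h, of v] prox_subgradient(1)[OF h, of w]
    by (cases "h ?p"; cases "h ?q") auto
  have 1: "a + inner (v - ?p) (?q - ?p) \<le> b" "b + inner (w - ?q) (?p - ?q) \<le> a"
    using prox_subgradient(2)[OF h, of v ?q] prox_subgradient(2)[OF h, of w ?p] ab by auto
  have "0 \<le> (norm ((w - ?q) - (v - ?p)))\<^sup>2" by simp
  also have "\<dots> = (norm (w - ?q))\<^sup>2 - (norm (v - ?p))\<^sup>2 - 2 * inner (v - ?p) (w - v)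
      + 2 * inner (v - ?p) (?q - ?p)"
    unfolding power2_norm_eq_inner by (simp add: inner_simps inner_commute)
  finally show "moreau h v + inner (v - ?p) (w - v) \<le> moreau h w"
    using 1 unfolding moreau_def ab by simp
  \<comment> \<open>Both sides are expansions of the squared norm of \<open>w - ?p\<close>.\<close>
  have "(norm (w - ?q))\<^sup>2 - 2 * inner (w - ?q) (?p - ?q) + (norm (?p - ?q))\<^sup>2
      = (norm (v - ?p))\<^sup>2 + 2 * inner (v - ?p) (w - v) + (norm (w - v))\<^sup>2"
    unfolding power2_norm_eq_inner by (simp add: inner_simps inner_commute)
  moreover have "0 \<le> (norm (?p - ?q))\<^sup>2" by simp
  ultimately show "moreau h w \<le> moreau h v + inner (v - ?p) (w - v) + (norm (w - v))\<^sup>2 / 2"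
    using 1(2) unfolding moreau_def ab real_of_ereal.simps by linarith
qed

subsection \<open>Smooth convex functions\<close>

text \<open>Averaging the subgradient inequalities based at the convex combination \<open>w\<close>
  cancels the linear terms.\<close>

lemma subgradients_imp_convex_on:
  fixes \<Phi> :: "'a::real_inner \<Rightarrow> real"
  assumes "\<And>x y. \<Phi> x + inner (D x) (y - x) \<le> \<Phi> y"
  shows "convex_on UNIV \<Phi>"
proof (rule convex_onI)
  fix t :: real and x y :: 'a assume t: "0 < t" "t < 1"
  define w where "w = (1 - t) *\<^sub>R x + t *\<^sub>R y"
  have "(1 - t) * (\<Phi> w + inner (D w) (x - w)) + t * (\<Phi> w + inner (D w) (y - w))
      \<le> (1 - t) * \<Phi> x + t * \<Phi> y"
    using t by (intro add_mono mult_left_mono assms) auto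
  moreover have "(1 - t) * (\<Phi> w + inner (D w) (x - w)) + t * (\<Phi> w + inner (D w) (y - w)) =
      \<Phi> w + inner (D w) ((1 - t) *\<^sub>R (x - w) + t *\<^sub>R (y - w))"
    by (simp add: inner_simps algebra_simps)
  moreover have "(1 - t) *\<^sub>R (x - w) + t *\<^sub>R (y - w) = 0"
    by (simp add: w_def algebra_simps)
  ultimately show "\<Phi> ((1 - t) *\<^sub>R x + t *\<^sub>R y) \<le> (1 - t) * \<Phi> x + t * \<Phi> y"
    by (simp flip: w_def)
qed simp

text \<open>Since \<open>grad\<close> is a definite description, both existence and uniqueness of
  the representing vector are at stake. Existence is the Riesz representation in
  coordinates.\<close>

lemma GDERIV_grad:
  fixes h :: "'a::euclidean_space \<Rightarrow> ereal"
  assumes "(\<lambda>y. real_of_ereal (h y)) differentiable (at x)"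
  shows "GDERIV (\<lambda>y. real_of_ereal (h y)) x :> grad h x"
proof -
  let ?r = "\<lambda>y. real_of_ereal (h y)"
  obtain F where F: "(?r has_derivative F) (at x)"
    using assms by (auto simp: differentiable_def)
  then have "linear F" by (rule has_derivative_linear)
  define D where "D = (\<Sum>b\<in>Basis. F b *\<^sub>R b)"
  have "F = (\<lambda>v. inner v D)"
  proof
    fix v
    have "F v = F (\<Sum>b\<in>Basis. inner v b *\<^sub>R b)" by (simp add: euclidean_representation)
    also have "\<dots> = (\<Sum>b\<in>Basis. inner v b * F b)"
      using \<open>linear F\<close> by (simp add: linear_sum linear_scale)
    finally show "F v = inner v D" by (simp add: D_def inner_sum_right mult.commute)
  qed
  with F have D: "GDERIV ?r x :> D" by (simp add: gderiv_def)
  moreover have "E = D" if "GDERIV ?r x :> E" for E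
  proof -
    have "(\<lambda>v. inner v E) = (\<lambda>v. inner v D)"
      using that D unfolding gderiv_def by (rule has_derivative_unique)
    then have "inner (E - D) E = inner (E - D) D" by (rule fun_cong)
    then have "inner (E - D) (E - D) = 0" by (simp add: inner_diff_right)
    then show ?thesis by simp
  qed
  ultimately show ?thesis unfolding grad_def by (rule theI)
qed

lemma DERIV_along_line:
  assumes "GDERIV r (a + t *\<^sub>R d) :> D"
  shows "((\<lambda>t. r (a + t *\<^sub>R d)) has_real_derivative inner d D) (at t)"
proof -
  have "((\<lambda>t. a + t *\<^sub>R d) has_derivative (\<lambda>s. s *\<^sub>R d)) (at t)"
    by (auto intro!: derivative_eq_intros)
  moreover have "(r has_derivative (\<lambda>h. inner h D)) (at (a + t *\<^sub>R d))"
    using assms unfolding gderiv_def .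
  ultimately have "((\<lambda>t. r (a + t *\<^sub>R d)) has_derivative (\<lambda>s. inner (s *\<^sub>R d) D)) (at t)"
    by (rule has_derivative_compose)
  then show ?thesis
    by (simp add: has_field_derivative_def mult_commute_abs)
qed

text \<open>Restriction to the line through \<open>x\<close> and \<open>y\<close> reduces this to
  the one-dimensional tangent inequality.\<close>

lemma convex_above_tangent_GDERIV:
  fixes r :: "'a::real_inner \<Rightarrow> real"
  assumes conv: "convex_on UNIV r" and D: "GDERIV r x :> D"
  shows "r x + inner D (y - x) \<le> r y"
proof -
  let ?l = "\<lambda>t. x + t *\<^sub>R (y - x)"
  have "convex_on UNIV (\<lambda>t. r (?l t))"
  proof (rule convex_onI)
    fix t a b :: real assume t: "0 < t" "t < 1"
    have "?l ((1 - t) *\<^sub>R a + t *\<^sub>R b) = (1 - t) *\<^sub>R ?l a + t *\<^sub>R ?l b"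
      by (simp add: algebra_simps)
    then show "r (?l ((1 - t) *\<^sub>R a + t *\<^sub>R b)) \<le> (1 - t) * r (?l a) + t * r (?l b)"
      using convex_onD[OF conv, of t "?l a" "?l b"] t by simp
  qed simp
  moreover have "((\<lambda>t. r (?l t)) has_real_derivative inner (y - x) D) (at 0)"
    using D by (intro DERIV_along_line) simp
  ultimately have "inner (y - x) D * (1 - 0) \<le> r (?l 1) - r (?l 0)"
    by (intro convex_on_imp_above_tangent[where A = UNIV]) auto
  then show ?thesis by (simp add: inner_commute)
qed

text \<open>The descent lemma.\<close>

lemma lipschitz_gradient_upper:
  fixes r :: "'a::real_inner \<Rightarrow> real"
  assumes D: "\<And>x. GDERIV r x :> D x" and lip: "\<beta>-lipschitz_on UNIV D"
  shows "r y \<le> r x + inner (D x) (y - x) + \<beta> / 2 * (norm (y - x))\<^sup>2"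
proof -
  define d where "d = y - x"
  \<comment> \<open>Up to a constant, \<open>r\<close> on the segment minus the claimed quadratic
    bound; the Lipschitz condition makes its derivative nonpositive.\<close>
  define s where "s = (\<lambda>t. r (x + t *\<^sub>R d) - t * inner d (D x) - t\<^sup>2 * (\<beta> / 2 * (norm d)\<^sup>2))"
  have "s 0 \<ge> s 1"
  proof (rule DERIV_nonpos_imp_nonincreasing[where f = s])
    fix t :: real assume t: "0 \<le> t" "t \<le> 1"
    let ?E = "inner d (D (x + t *\<^sub>R d)) - inner d (D x) - (2 * t) * (\<beta> / 2 * (norm d)\<^sup>2)"
    have "DERIV s t :> ?E" unfolding s_def
      by (rule derivative_eq_intros DERIV_along_line D refl | simp)+
    moreover have "?E \<le> 0"
    proof -
      have "inner d (D (x + t *\<^sub>R d)) - inner d (D x) = inner d (D (x + t *\<^sub>R d) - D x)"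
        by (simp add: inner_diff_right)
      also have "\<dots> \<le> norm d * norm (D (x + t *\<^sub>R d) - D x)" by (rule norm_cauchy_schwarz)
      also have "\<dots> \<le> norm d * (\<beta> * norm (t *\<^sub>R d))"
        using lipschitz_onD[OF lip, of "x + t *\<^sub>R d" x]
        by (intro mult_left_mono) (auto simp: dist_norm)
      also have "\<dots> = (2 * t) * (\<beta> / 2 * (norm d)\<^sup>2)"
        using t by (simp add: power2_eq_square)
      finally show ?thesis by simp
    qed
    ultimately show "\<exists>E. DERIV s t :> E \<and> E \<le> 0" by blast
  qed simp
  then show ?thesis by (simp add: s_def d_def inner_commute)
qed

lemma convex_fun_real_of_ereal:
  fixes h :: "'a::real_vector \<Rightarrow> ereal"
  assumes "convex_fun h" "\<And>x. \<bar>h x\<bar> \<noteq> \<infinity>"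
  shows "convex_on UNIV (\<lambda>x. real_of_ereal (h x))"
proof (rule convex_onI)
  fix t :: real and x y :: 'a assume t: "0 < t" "t < 1"
  let ?w = "(1 - t) *\<^sub>R x + t *\<^sub>R y"
  have "h ?w \<le> ereal (1 - t) * h x + ereal t * h y"
    using assms(1) t by (auto simp: convex_fun_def)
  then show "real_of_ereal (h ?w) \<le> (1 - t) * real_of_ereal (h x) + t * real_of_ereal (h y)"
    using assms(2)[of x] assms(2)[of y] assms(2)[of ?w] by (cases "h x"; cases "h y"; cases "h ?w") auto
qed simp

subsection \<open>Inexact gradient descent\<close>

text \<open>Compactness gives a positive gap on the sphere of radius \<epsilon>; convexity along
  rays from \<open>z\<close> propagates it outward at least linearly.\<close>

lemma unique_minimizer_sharp_away:
  fixes \<Phi> :: "'a::euclidean_space \<Rightarrow> real"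
  assumes conv: "convex_on UNIV \<Phi>" and min: "\<And>y. y \<noteq> z \<Longrightarrow> \<Phi> z < \<Phi> y" and "\<epsilon> > 0"
  shows "\<exists>c>0. \<forall>y. norm (y - z) \<ge> \<epsilon> \<longrightarrow> c * norm (y - z) \<le> \<Phi> y - \<Phi> z"
proof -
  have "continuous_on (sphere z \<epsilon>) \<Phi>"
    using convex_on_continuous[OF open_UNIV conv] continuous_on_subset by blast
  moreover have "sphere z \<epsilon> \<noteq> {}" using \<open>\<epsilon> > 0\<close> by simp
  ultimately obtain p where p: "p \<in> sphere z \<epsilon>" "\<And>y. y \<in> sphere z \<epsilon> \<Longrightarrow> \<Phi> p \<le> \<Phi> y"
    using continuous_attains_inf[OF compact_sphere] by metis
  have "p \<noteq> z" using p(1) \<open>\<epsilon> > 0\<close> by auto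
  define c where "c = (\<Phi> p - \<Phi> z) / \<epsilon>"
  have "c > 0" using min[OF \<open>p \<noteq> z\<close>] \<open>\<epsilon> > 0\<close> by (simp add: c_def)
  moreover have "c * norm (y - z) \<le> \<Phi> y - \<Phi> z" if y: "norm (y - z) \<ge> \<epsilon>" for y
  proof -
    define t where "t = \<epsilon> / norm (y - z)"
    define w where "w = (1 - t) *\<^sub>R z + t *\<^sub>R y"
    have r: "norm (y - z) > 0" using y \<open>\<epsilon> > 0\<close> by linarith
    have t: "0 < t" "t \<le> 1" using y r \<open>\<epsilon> > 0\<close> by (auto simp: t_def)
    have "w - z = t *\<^sub>R (y - z)" by (simp add: w_def algebra_simps)
    then have "norm (w - z) = \<epsilon>" using r \<open>\<epsilon> > 0\<close> by (simp add: t_def)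
    then have "\<Phi> p \<le> \<Phi> w" by (intro p(2)) (simp add: dist_norm norm_minus_commute)
    also have "\<Phi> w \<le> (1 - t) * \<Phi> z + t * \<Phi> y"
      unfolding w_def using convex_onD[OF conv, of t z y] t by simp
    finally have "\<Phi> p - \<Phi> z \<le> t * (\<Phi> y - \<Phi> z)" by (simp add: algebra_simps)
    then show ?thesis using r \<open>\<epsilon> > 0\<close> by (simp add: c_def t_def field_simps)
  qed
  ultimately show ?thesis by blast
qed

text \<open>Outside the \<epsilon>-ball, growth at rate \<open>c\<close> forces
  \<open>norm (D (x k)) \<ge> c\<close> by Cauchy-Schwarz, so small gradients confine the iterates
  to the ball.\<close>

lemma gradients_tendsto_0_imp_minimizing:
  fixes \<Phi> :: "'a::euclidean_space \<Rightarrow> real"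
  assumes sub: "\<And>x y. \<Phi> x + inner (D x) (y - x) \<le> \<Phi> y"
    and min: "\<And>y. y \<noteq> z \<Longrightarrow> \<Phi> z < \<Phi> y"
    and lim: "(\<lambda>k. D (x k)) \<longlonglongrightarrow> 0"
  shows "x \<longlonglongrightarrow> z"
proof (rule tendstoI)
  fix \<epsilon> :: real assume "\<epsilon> > 0"
  obtain c where c: "c > 0" "\<And>y. norm (y - z) \<ge> \<epsilon> \<Longrightarrow> c * norm (y - z) \<le> \<Phi> y - \<Phi> z"
    using unique_minimizer_sharp_away[OF subgradients_imp_convex_on[OF sub] min \<open>\<epsilon> > 0\<close>] by blast
  have "eventually (\<lambda>k. norm (D (x k)) < c) sequentially"
    using tendsto_norm_zero[OF lim] c(1) by (rule order_tendstoD(2))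
  then show "eventually (\<lambda>k. dist (x k) z < \<epsilon>) sequentially"
  proof eventually_elim
    case (elim k)
    show ?case
    proof (rule ccontr)
      assume "\<not> ?thesis"
      then have far: "norm (x k - z) \<ge> \<epsilon>" by (simp add: dist_norm)
      have "c * norm (x k - z) \<le> \<Phi> (x k) - \<Phi> z" by (rule c(2)[OF far])
      also have "\<dots> \<le> inner (D (x k)) (x k - z)"
        using sub[of "x k" z] by (simp add: inner_simps)
      also have "\<dots> \<le> norm (D (x k)) * norm (x k - z)" by (rule norm_cauchy_schwarz)
      also have "\<dots> < c * norm (x k - z)"
        using elim far \<open>\<epsilon> > 0\<close> by (intro mult_strict_right_mono) auto
      finally show False by simp
    qed
  qed
qed

text \<open>\<open>V\<close> decreases and is bounded below, hence converges; its vanishing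
  differences dominate \<open>a\<close>.\<close>

lemma telescoping_tendsto_0:
  fixes V a :: "nat \<Rightarrow> real"
  assumes "\<And>k. 0 \<le> a k" "\<And>k. V (Suc k) + a k \<le> V k" "\<And>k. m \<le> V k"
  shows "a \<longlonglongrightarrow> 0"
proof -
  have "decseq V" by (rule decseq_SucI) (use assms(1,2) in \<open>smt (verit)\<close>)
  then obtain l where l: "V \<longlonglongrightarrow> l" using decseq_convergent[of V m] assms(3) by blast
  have "(\<lambda>k. V k - V (Suc k)) \<longlonglongrightarrow> l - l"
    by (intro tendsto_diff l LIMSEQ_Suc[OF l])
  then have lim: "(\<lambda>k. V k - V (Suc k)) \<longlonglongrightarrow> 0" by simp
  have "a k \<le> V k - V (Suc k)" for k using assms(2)[of k] by simp
  then show ?thesis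
    by (intro tendsto_sandwich[OF _ _ tendsto_const lim]) (auto simp: assms(1))
qed

text \<open>Young's inequality with a free weight, by completing the square.\<close>

lemma inner_le_weighted_squares:
  fixes a b :: "'a::real_inner"
  assumes "s > 0"
  shows "c * inner a b \<le> s * (norm b)\<^sup>2 + c\<^sup>2 / (4 * s) * (norm a)\<^sup>2"
proof -
  have "0 \<le> (norm ((2 * s) *\<^sub>R b - c *\<^sub>R a))\<^sup>2 / (4 * s)" using assms by simp
  also have "(norm ((2 * s) *\<^sub>R b - c *\<^sub>R a))\<^sup>2 =
      4 * s * (s * (norm b)\<^sup>2) - 4 * s * (c * inner a b) + c\<^sup>2 * (norm a)\<^sup>2"
    unfolding power2_norm_eq_inner
    by (simp add: inner_simps inner_commute power2_eq_square algebra_simps)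
  also have "\<dots> / (4 * s) = s * (norm b)\<^sup>2 - c * inner a b + c\<^sup>2 / (4 * s) * (norm a)\<^sup>2"
    using assms by (simp add: field_simps)
  finally show ?thesis by simp
qed

text \<open>The Lyapunov function is \<open>\<Phi> (x k) + \<phi> * (norm (e k))\<^sup>2\<close>.  The polynomial equation for \<open>\<phi>\<close>
  says that \<open>s\<^sub>0 = \<mu>\<^sup>2 / (4 * \<phi> * (1 - 2 * \<alpha>\<^sup>2))\<close> equals \<open>M / 2 + 2 * \<alpha>\<^sup>2 * \<phi>\<close>, and the step-size bound
  is then \<open>1 / \<tau> > 2 * s\<^sub>0\<close>; this slack is split evenly between the two squares.\<close>

theorem inexact_gradient_descent_converges:
  fixes \<Phi> :: "'a::euclidean_space \<Rightarrow> real"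
  assumes lower: "\<And>x y. \<Phi> x + inner (D x) (y - x) \<le> \<Phi> y"
    and upper: "\<And>x y. \<Phi> y \<le> \<Phi> x + inner (D x) (y - x) + M / 2 * (norm (y - x))\<^sup>2"
    and min: "\<And>y. y \<noteq> z \<Longrightarrow> \<Phi> z < \<Phi> y"
    and step: "\<And>k. x (Suc k) = x k - \<tau> *\<^sub>R (D (x k) - \<mu> *\<^sub>R e k)"
    and err: "\<And>k. (norm (e (Suc k)))\<^sup>2 \<le> 2 * \<alpha>\<^sup>2 * ((norm (e k))\<^sup>2 + (norm (x (Suc k) - x k))\<^sup>2)"
    and "\<mu> > 0" "2 * \<alpha>\<^sup>2 < 1" "\<phi> > 0"
    and poly: "8 * \<alpha>\<^sup>2 * (1 - 2 * \<alpha>\<^sup>2) * \<phi>\<^sup>2 + 2 * M * (1 - 2 * \<alpha>\<^sup>2) * \<phi> - \<mu>\<^sup>2 = 0"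
    and \<tau>: "0 < \<tau>" "\<tau> < 2 * \<phi> * (1 - 2 * \<alpha>\<^sup>2) / \<mu>\<^sup>2"
  shows "x \<longlonglongrightarrow> z"
proof -
  define q where "q = 1 - 2 * \<alpha>\<^sup>2"
  have q: "q > 0" using \<open>2 * \<alpha>\<^sup>2 < 1\<close> by (simp add: q_def)
  define s0 where "s0 = \<mu>\<^sup>2 / (4 * \<phi> * q)"
  have s0: "s0 > 0" using \<open>\<mu> > 0\<close> \<open>\<phi> > 0\<close> q by (simp add: s0_def)
  have "\<mu>\<^sup>2 = (4 * \<phi> * q) * (M / 2 + 2 * \<alpha>\<^sup>2 * \<phi>)"
    using poly unfolding q_def[symmetric] by (simp add: algebra_simps power2_eq_square)
  then have s0_eq: "s0 = M / 2 + 2 * \<alpha>\<^sup>2 * \<phi>"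
    using \<open>\<phi> > 0\<close> q unfolding s0_def by simp
  have "\<tau> < 1 / (2 * s0)"
    using \<tau>(2) \<open>\<phi> > 0\<close> q unfolding s0_def q_def[symmetric] by (simp add: field_simps)
  then have slack: "2 * s0 < 1 / \<tau>" using \<tau>(1) s0 by (simp add: field_simps)
  define \<eta> where "\<eta> = (1 / \<tau> - 2 * s0) / 2"
  have \<eta>: "\<eta> > 0" using slack by (simp add: \<eta>_def)
  define s where "s = s0 + \<eta>"
  have s: "s > s0" "s > 0" using s0 \<eta> by (auto simp: s_def)
  \<comment> \<open>The net coefficient with which the squared error decreases. It would be zero for
    \<open>s = s0\<close>, so the strict inequality \<open>s > s0\<close> makes it positive.\<close>
  define \<theta> where "\<theta> = \<phi> * q - \<mu>\<^sup>2 / (4 * s)"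
  have "\<mu>\<^sup>2 / (4 * s) < \<mu>\<^sup>2 / (4 * s0)"
    using s s0 \<open>\<mu> > 0\<close> by (simp add: divide_strict_left_mono)
  also have "\<mu>\<^sup>2 / (4 * s0) = \<phi> * q"
    using \<open>\<mu> > 0\<close> \<open>\<phi> > 0\<close> q by (simp add: s0_def)
  finally have \<theta>: "\<theta> > 0" by (simp add: \<theta>_def)
  define d where "d = (\<lambda>k. x (Suc k) - x k)"
  \<comment> \<open>The gradient is a combination of error and step, so it vanishes in the limit
    once both do.\<close>
  have Dd: "D (x k) = \<mu> *\<^sub>R e k - (1 / \<tau>) *\<^sub>R d k" for k
    using \<tau>(1) by (simp add: d_def step)
  define V where "V = (\<lambda>k. \<Phi> (x k) + \<phi> * (norm (e k))\<^sup>2)"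
  have decrease: "V (Suc k) + (\<eta> * (norm (d k))\<^sup>2 + \<theta> * (norm (e k))\<^sup>2) \<le> V k" for k
  proof -
    have "\<Phi> (x (Suc k)) \<le> \<Phi> (x k) + inner (D (x k)) (d k) + M / 2 * (norm (d k))\<^sup>2"
      using upper[of "x (Suc k)" "x k"] by (simp add: d_def)
    moreover have "inner (D (x k)) (d k) = \<mu> * inner (e k) (d k) - 1 / \<tau> * (norm (d k))\<^sup>2"
      unfolding Dd power2_norm_eq_inner by (simp add: inner_simps)
    moreover have "\<mu> * inner (e k) (d k) \<le> s * (norm (d k))\<^sup>2 + \<mu>\<^sup>2 / (4 * s) * (norm (e k))\<^sup>2"
      by (rule inner_le_weighted_squares[OF s(2)])
    moreover have "\<phi> * (norm (e (Suc k)))\<^sup>2 \<le> \<phi> * (2 * \<alpha>\<^sup>2 * ((norm (e k))\<^sup>2 + (norm (d k))\<^sup>2))"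
      using err[of k] \<open>\<phi> > 0\<close> by (intro mult_left_mono) (auto simp: d_def)
    ultimately have "V (Suc k) \<le> \<Phi> (x k) + s * (norm (d k))\<^sup>2 + \<mu>\<^sup>2 / (4 * s) * (norm (e k))\<^sup>2
        - 1 / \<tau> * (norm (d k))\<^sup>2 + M / 2 * (norm (d k))\<^sup>2
        + \<phi> * (2 * \<alpha>\<^sup>2 * ((norm (e k))\<^sup>2 + (norm (d k))\<^sup>2))"
      unfolding V_def by linarith
    also have "\<dots> = V k + (s - 1 / \<tau> + M / 2 + 2 * \<alpha>\<^sup>2 * \<phi>) * (norm (d k))\<^sup>2
        + (\<mu>\<^sup>2 / (4 * s) - \<phi> * q) * (norm (e k))\<^sup>2"
      unfolding V_def q_def by (simp add: algebra_simps)
    also have "s - 1 / \<tau> + M / 2 + 2 * \<alpha>\<^sup>2 * \<phi> = - \<eta>"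
      using s0_eq by (simp add: s_def \<eta>_def field_simps)
    also have "\<mu>\<^sup>2 / (4 * s) - \<phi> * q = - \<theta>" by (simp add: \<theta>_def)
    finally show ?thesis by simp
  qed
  have "\<Phi> z \<le> \<Phi> (x k)" for k
    using min[of "x k"] by (cases "x k = z") auto
  then have "\<Phi> z \<le> V k" for k
    using \<open>\<phi> > 0\<close> unfolding V_def by (smt (verit) mult_nonneg_nonneg zero_le_power2)
  then have lim: "(\<lambda>k. \<eta> * (norm (d k))\<^sup>2 + \<theta> * (norm (e k))\<^sup>2) \<longlonglongrightarrow> 0"
    using \<eta> \<theta> decrease by (intro telescoping_tendsto_0[where V = V and m = "\<Phi> z"]) auto
  have "(\<lambda>k. \<eta> * (norm (d k))\<^sup>2) \<longlonglongrightarrow> 0" "(\<lambda>k. \<theta> * (norm (e k))\<^sup>2) \<longlonglongrightarrow> 0"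
    by (rule tendsto_sandwich[OF _ _ tendsto_const lim]; use \<eta> \<theta> in simp)+
  \<comment> \<open>Dividing by the positive weights and taking roots recovers the norms
    themselves.\<close>
  then have "(\<lambda>k. sqrt (\<eta> * (norm (d k))\<^sup>2 / \<eta>)) \<longlonglongrightarrow> sqrt (0 / \<eta>)"
    "(\<lambda>k. sqrt (\<theta> * (norm (e k))\<^sup>2 / \<theta>)) \<longlonglongrightarrow> sqrt (0 / \<theta>)"
    using \<eta> \<theta> by (auto intro!: tendsto_intros)
  then have de: "d \<longlonglongrightarrow> 0" "e \<longlonglongrightarrow> 0"
    using \<eta> \<theta> by (simp_all add: tendsto_norm_zero_iff)
  then have "(\<lambda>k. \<mu> *\<^sub>R e k - (1 / \<tau>) *\<^sub>R d k) \<longlonglongrightarrow> \<mu> *\<^sub>R 0 - (1 / \<tau>) *\<^sub>R 0"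
    by (intro tendsto_intros)
  then have "(\<lambda>k. D (x k)) \<longlonglongrightarrow> 0" by (simp flip: Dd)
  with lower min show ?thesis by (rule gradients_tendsto_0_imp_minimizing)
qed

section \<open>Application to the bi-level scheme\<close>

theorem theorem4p3:
  fixes f g :: "real ^ 'n \<Rightarrow> ereal"
    and G :: "nat \<Rightarrow> real \<Rightarrow> real ^ 'n \<Rightarrow> real ^ 'n \<Rightarrow> real ^ 'n"
    and L :: nat
    and \<beta> lam \<mu> \<tau> \<alpha> \<phi> :: real
    and x0 u0 :: "real ^ 'n"
    and x u :: "nat \<Rightarrow> real ^ 'n"
  assumes f: "no_minus_infty f" "convex_fun f" "\<beta> > 0" "lipschitz_differentiable \<beta> f"
    and g: "proper_fun g" "convex_fun g" "lsc_fun g"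
    and pos: "lam > 0" "\<mu> > 0"
    and L: "L \<noteq> 0"
    and init: "x 0 = x0" "u 0 = u0"
    and x_step: "\<And>k. x (Suc k) = x k - \<tau> *\<^sub>R grad_x_F f \<mu> (x k) (u k)"
    and u_step: "\<And>k. u (Suc k) = G L (lam / \<mu>) (x (Suc k)) (u k)"
    and unique_sol: "\<exists>!z. is_arg_min (bilevel_obj f g lam \<mu>) (\<lambda>_. True) z"
    and \<alpha>: "0 < \<alpha>" "\<alpha> < 1 / sqrt 2"
    and contraction: "\<And>k. norm (G L (lam / \<mu>) (x (Suc k)) (u k) - lower_sol g lam \<mu> (x (Suc k)))
                            \<le> \<alpha> * norm (u k - lower_sol g lam \<mu> (x (Suc k)))"
    and \<phi>: "\<phi> > 0"
           "8 * \<alpha>\<^sup>2 * (1 - 2 * \<alpha>\<^sup>2) * \<phi>\<^sup>2 + 2 * (\<beta> + \<mu>) * (1 - 2 * \<alpha>\<^sup>2) * \<phi> - \<mu>\<^sup>2 = 0"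
    and \<tau>: "0 < \<tau>" "\<tau> < 2 * \<phi> * (1 - 2 * \<alpha>\<^sup>2) / \<mu>\<^sup>2"
  shows "x \<longlonglongrightarrow> argmin (bilevel_obj f g lam \<mu>)"
proof -
  define h where "h = scale_fun (lam / \<mu>) g"
  have h: "proper_fun h" "convex_fun h" "lsc_fun h"
    using g pos by (simp_all add: h_def proper_fun_scale convex_fun_scale lsc_fun_scale)
  have lower_sol: "lower_sol g lam \<mu> = prox h"
    by (rule ext) (simp add: lower_sol_def h_def)
  define r where "r = (\<lambda>y. real_of_ereal (f y))"
  have f_eq: "f y = ereal (r y)" for y
    using f(4) by (simp add: r_def lipschitz_differentiable_def ereal_real)
  have r_grad: "GDERIV r y :> grad f y" for y
    using f(4) GDERIV_grad unfolding r_def lipschitz_differentiable_def by blast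
  have lip: "\<beta>-lipschitz_on UNIV (grad f)"
    using f(4) by (simp add: lipschitz_differentiable_def)
  have r_conv: "convex_on UNIV r"
    unfolding r_def using f(2,4) by (intro convex_fun_real_of_ereal) (auto simp: lipschitz_differentiable_def)
  \<comment> \<open>The real form of the bi-level objective:
    \<open>lam = \<mu> * (lam / \<mu>)\<close> turns the \<open>g\<close> term and the coupling term
    at the proximal point into \<open>\<mu> * moreau h y\<close>.\<close>
  define \<Phi> where "\<Phi> = (\<lambda>y. r y + \<mu> * moreau h y)"
  define D where "D = (\<lambda>y. grad f y + \<mu> *\<^sub>R (y - prox h y))"
  have obj: "bilevel_obj f g lam \<mu> y = ereal (\<Phi> y)" for y
  proof -
    obtain a where a: "h (prox h y) = ereal a"
      using prox_subgradient(1)[OF h, of y] by auto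
    then have "scale_fun lam g (prox h y) = ereal (\<mu> * a)"
      using pos unfolding h_def scale_fun_def by (cases "g (prox h y)") (auto simp: h_def scale_fun_def)
    then show ?thesis
      by (simp add: bilevel_obj_def F_obj_def lower_sol f_eq \<Phi>_def moreau_def a algebra_simps)
  qed
  obtain z where z: "is_arg_min (bilevel_obj f g lam \<mu>) (\<lambda>_. True) z"
    "\<And>y. is_arg_min (bilevel_obj f g lam \<mu>) (\<lambda>_. True) y \<Longrightarrow> y = z"
    using unique_sol by blast
  have argmin_z: "argmin (bilevel_obj f g lam \<mu>) = z"
    unfolding argmin_def using z by (rule the_equality)
  have min: "\<Phi> z < \<Phi> y" if "y \<noteq> z" for y
    using z that unfolding is_arg_min_UNIV_iff obj ereal_less_eq by (metis order_trans not_le)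
  define e where "e = (\<lambda>k. u k - prox h (x k))"
  have "x \<longlonglongrightarrow> z"
  proof (rule inexact_gradient_descent_converges)
    show "\<Phi> a + inner (D a) (b - a) \<le> \<Phi> b" for a b
    proof -
      have "\<mu> * (moreau h a + inner (a - prox h a) (b - a)) \<le> \<mu> * moreau h b"
        using pos by (intro mult_left_mono moreau_lower h) auto
      then show ?thesis
        using convex_above_tangent_GDERIV[OF r_conv r_grad, of a b]
        by (simp add: \<Phi>_def D_def inner_add_left algebra_simps)
    qed
    show "\<Phi> b \<le> \<Phi> a + inner (D a) (b - a) + (\<beta> + \<mu>) / 2 * (norm (b - a))\<^sup>2" for a b
    proof -
      have "\<mu> * moreau h b \<le> \<mu> * (moreau h a + inner (a - prox h a) (b - a) + (norm (b - a))\<^sup>2 / 2)"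
        using pos by (intro mult_left_mono moreau_upper h) auto
      moreover have "inner (D a) (b - a) = inner (grad f a) (b - a) + \<mu> * inner (a - prox h a) (b - a)"
        by (simp add: D_def inner_add_left)
      moreover note lipschitz_gradient_upper[OF r_grad lip, of b a]
      ultimately show ?thesis
        by (simp add: \<Phi>_def distrib_left add_divide_distrib distrib_right)
    qed
    \<comment> \<open>Splitting \<open>x k - u k\<close> into \<open>x k - prox h (x k)\<close> and
      \<open>- e k\<close> exhibits the update as a perturbed gradient step.\<close>
    show "x (Suc k) = x k - \<tau> *\<^sub>R (D (x k) - \<mu> *\<^sub>R e k)" for k
      by (simp add: x_step grad_x_F_def D_def e_def algebra_simps)
    show "(norm (e (Suc k)))\<^sup>2 \<le> 2 * \<alpha>\<^sup>2 * ((norm (e k))\<^sup>2 + (norm (x (Suc k) - x k))\<^sup>2)" for k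
    proof -
      let ?d = "x (Suc k) - x k"
      \<comment> \<open>The contraction refers to the new target \<open>prox h (x (Suc k))\<close>,
        so the old error is corrected by the displacement of the target, which is at most the step
        length.\<close>
      have "u k - prox h (x (Suc k)) = e k + (prox h (x k) - prox h (x (Suc k)))"
        by (simp add: e_def)
      then have "norm (u k - prox h (x (Suc k))) \<le> norm (e k) + norm (prox h (x k) - prox h (x (Suc k)))"
        using norm_triangle_ineq by metis
      also have "\<dots> \<le> norm (e k) + norm ?d"
        using prox_nonexpansive[OF h, of "x k" "x (Suc k)"] by (simp add: norm_minus_commute)
      finally have "norm (e (Suc k)) \<le> \<alpha> * (norm (e k) + norm ?d)"
        using contraction[of k] \<alpha>(1) unfolding e_def u_step lower_sol
        by (meson order_trans mult_left_mono less_imp_le)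
      then have "(norm (e (Suc k)))\<^sup>2 \<le> (\<alpha> * (norm (e k) + norm ?d))\<^sup>2"
        by (intro power_mono) auto
      also have "\<dots> = \<alpha>\<^sup>2 * (norm (e k) + norm ?d)\<^sup>2" by (rule power_mult_distrib)
      \<comment> \<open>Squaring a sum of two terms costs a factor 2; hence the threshold
        \<open>1 / sqrt 2\<close> for \<alpha>.\<close>
      also have "\<dots> \<le> \<alpha>\<^sup>2 * (2 * ((norm (e k))\<^sup>2 + (norm ?d)\<^sup>2))"
        using sum_squares_bound[of "norm (e k)" "norm ?d"]
        by (intro mult_left_mono) (auto simp: power2_sum)
      finally show ?thesis by (simp add: algebra_simps)
    qed
    have "\<alpha>\<^sup>2 < (1 / sqrt 2)\<^sup>2" using \<alpha> by (intro power_strict_mono) auto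
    then show "2 * \<alpha>\<^sup>2 < 1" by (simp add: power_divide)
  qed (use min pos \<phi> \<tau> in auto)
  then show ?thesis unfolding argmin_z .
qed

end
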